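(* Let $\theta\in\mathbb{R}$ with $|\theta|<\pi/2$ and let $\gamma>0$ be such that $$\delta(\gamma,\theta):=\gamma\cos\theta\,\sqrt{4+(\gamma^2+4\gamma)\cos^2\theta}\in[0,1).$$ Then every function $f\in\mathcal{C}_\theta(\gamma)$ is univalent in $\mathbb{D}$.
   Context: $\mathbb{D}=\{z\in\mathbb{C}:|z|<1\}$. $\mathcal{A}$ is the class of analytic functions $f$ in $\mathbb{D}$ with $f(0)=f'(0)-1=0$. For $|\theta|<\pi/2$ and $\gamma>0$, $\mathcal{C}_\theta(\gamma)$ is the class of all $f\in\mathcal{A}$ (with $f'$ non-vanishing in $\mathbb{D}$) such that $$\operatorname{Re}\left(e^{i\theta}\left(1+\frac{zf''(z)}{f'(z)}\right)\right)<\left(1+\frac{\gamma}{2}\right)\cos\theta\quad\text{for all } z\in\mathbb{D}.$$ Univalent means injective. *)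

theory Defs
  imports "HOL-Complex_Analysis.Complex_Analysis"
begin

abbreviation unit_disc :: "complex set" where
  "unit_disc \<equiv> ball 0 1"

text \<open>
  Functions on the disc are total functions on the complex plane; only their restriction to the
  open disc matters, so derivatives at points of the disc are the usual ones.
\<close>

definition class_A :: "(complex \<Rightarrow> complex) set" where
  "class_A = {f. f holomorphic_on unit_disc \<and> f 0 = 0 \<and> deriv f 0 - 1 = 0}"

definition class_C :: "real \<Rightarrow> real \<Rightarrow> (complex \<Rightarrow> complex) set" where
  "class_C \<theta> \<gamma> = {f \<in> class_A. (\<forall>z\<in>unit_disc. deriv f z \<noteq> 0) \<and>
     (\<forall>z\<in>unit_disc. Re (exp (\<i> * of_real \<theta>) * (1 + z * deriv (deriv f) z / deriv f z))
        < (1 + \<gamma> / 2) * cos \<theta>)}"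

definition delta :: "real \<Rightarrow> real \<Rightarrow> real" where
  "delta \<gamma> \<theta> = \<gamma> * cos \<theta> * sqrt (4 + (\<gamma>\<^sup>2 + 4 * \<gamma>) * (cos \<theta>)\<^sup>2)"

end

(*
  Since sqrt (4 + ...) >= 2, the hypothesis forces t = gamma cos theta < 1/2. The half-plane
  condition and the Schwarz lemma give |z f''/f'| <= t |z| / (1 - |z|), hence Becker's criterion
  (1 - |z|^2) |z f''/f'| <= 1.

  Becker's criterion is proved with the chain G l u = f u + l u f'(u), which is Loewner's chain
  after a change of variables, on the region |u|^2 (1 + l) <= r^2 < 1. The triples (u, v, l) with
  u ~= v and G l u = G l v form a compact set, and none exists for large l. At a triple with
  maximal l, both points could be moved on to a slightly larger l, so there is none at all;
  the case l = 0 is the injectivity of f.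
*)
theory Submission
  imports Defs
begin

section \<open>Injectivity and perturbation tools for holomorphic functions\<close>

text \<open>Removing the linear map with slope \<open>c\<close> leaves a function with Lipschitz
  constant \<open>cmod c / 2\<close> on the convex set, so it cannot cancel the stretching by
  \<open>cmod c\<close>.\<close>

lemma inj_on_if_deriv_near_const:
  fixes g :: "complex \<Rightarrow> complex"
  assumes "convex S"
    and der: "\<And>z. z \<in> S \<Longrightarrow> (g has_field_derivative g' z) (at z)"
    and near: "\<And>z. z \<in> S \<Longrightarrow> cmod (g' z - c) \<le> cmod c / 2"
    and "c \<noteq> 0"
  shows "inj_on g S"
proof (rule inj_onI)
  fix x y assume xy: "x \<in> S" "y \<in> S" "g x = g y"
  have "cmod ((g x - c * x) - (g y - c * y)) \<le> cmod c / 2 * cmod (x - y)"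
  proof (rule field_differentiable_bound[OF \<open>convex S\<close> _ near xy(1,2)])
    fix z assume "z \<in> S"
    show "((\<lambda>x. g x - c * x) has_field_derivative g' z - c) (at z within S)"
      using der[OF \<open>z \<in> S\<close>]
      by (auto intro!: derivative_eq_intros simp: has_field_derivative_at_within)
  qed
  also have "(g x - c * x) - (g y - c * y) = - (c * (x - y))"
    using xy by (simp add: algebra_simps)
  finally have "cmod c * cmod (x - y) \<le> cmod c / 2 * cmod (x - y)"
    by (simp add: norm_mult)
  then show "x = y"
    using \<open>c \<noteq> 0\<close> by (auto simp: field_simps)
qed

text \<open>A first-order implicit function statement: one Newton step from \<open>a\<close> gives
  the approximate solution, and a true one lies within \<epsilon> h of it. It exists because a
  holomorphic function whose modulus at the centre of a disc is below all its boundary values has a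
  zero inside.\<close>

lemma perturbed_root:
  fixes \<phi> \<psi> :: "complex \<Rightarrow> complex"
  assumes "open S" "a \<in> S" and hol: "\<phi> holomorphic_on S" "\<psi> holomorphic_on S"
    and D: "(\<phi> has_field_derivative D) (at a)" "D \<noteq> 0" and "\<epsilon> > 0"
  shows "\<forall>\<^sub>F h in at_right 0. \<exists>z. \<phi> z + of_real h * \<psi> z = \<phi> a \<and>
           cmod (z - (a - of_real h * \<psi> a / D)) < \<epsilon> * h"
proof -
  define M where "M = cmod (\<psi> a / D) + \<epsilon>"
  have "M > 0" using \<open>\<epsilon> > 0\<close> by (simp add: M_def add_nonneg_pos)
  \<comment> \<open>For z in the closed disc of radius \<epsilon> h about the Newton point,
    \<open>M * h\<close> bounds the distance to \<open>a\<close>. The two tolerances are chosen so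
    that the linearisation error there is at most a third of
    \<open>cmod D * \<epsilon> * h\<close>.\<close>
  define e where "e = cmod D * \<epsilon> / (6 * M)"
  define e' where "e' = cmod D * \<epsilon> / 6"
  have "e > 0" "e' > 0" using D(2) \<open>\<epsilon> > 0\<close> \<open>M > 0\<close> by (auto simp: e_def e'_def)
  have sum_e: "e * M + e' = cmod D * \<epsilon> / 3" using \<open>M > 0\<close> by (simp add: e_def e'_def)
  obtain d1 where d1: "d1 > 0" "\<And>z. cmod (z - a) < d1 \<Longrightarrow> cmod (\<phi> z - \<phi> a - D * (z - a)) \<le> e * cmod (z - a)"
    using D(1) \<open>e > 0\<close> unfolding has_field_derivative_def has_derivative_at_alt by blast
  have "isCont \<psi> a"
    using hol(2) \<open>open S\<close> \<open>a \<in> S\<close> continuous_on_eq_continuous_at holomorphic_on_imp_continuous_on by blast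
  then obtain d2 where d2: "d2 > 0" "\<And>z. cmod (z - a) < d2 \<Longrightarrow> cmod (\<psi> z - \<psi> a) < e'"
    using \<open>e' > 0\<close> unfolding continuous_at_eps_delta dist_norm by blast
  obtain d3 where d3: "d3 > 0" "ball a d3 \<subseteq> S"
    using \<open>open S\<close> \<open>a \<in> S\<close> openE by blast
  define d where "d = Min {d1, d2, d3}"
  have "d > 0" using d1 d2 d3 by (simp add: d_def)
  have "\<forall>\<^sub>F h in at_right 0. h < d / M"
    using \<open>d > 0\<close> \<open>M > 0\<close> by (intro eventually_at_rightI[of 0 "d / M"]) auto
  moreover have "\<forall>\<^sub>F h in at_right (0::real). h > 0"
    by (rule eventually_at_right_less)
  ultimately show ?thesis
  proof eventually_elim
    case (elim h)
    define \<xi> where "\<xi> = a - of_real h * \<psi> a / D"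
    define g where "g = (\<lambda>z. \<phi> z + of_real h * \<psi> z - \<phi> a)"
    have "h * M < d" using elim \<open>M > 0\<close> by (simp add: field_simps)
    have close: "cmod (z - a) \<le> h * M" if "z \<in> cball \<xi> (\<epsilon> * h)" for z
    proof -
      have "cmod (z - a) \<le> cmod (z - \<xi>) + cmod (\<xi> - a)"
        by (metis norm_diff_triangle_ineq add_diff_eq diff_add_cancel norm_triangle_ineq)
      also have "\<dots> \<le> \<epsilon> * h + h * cmod (\<psi> a / D)"
        using that elim by (simp add: \<xi>_def dist_norm norm_minus_commute norm_mult norm_divide)
      finally show ?thesis by (simp add: M_def algebra_simps)
    qed
    have err: "cmod (g z - D * (z - \<xi>)) \<le> cmod D * \<epsilon> * h / 3" if "z \<in> cball \<xi> (\<epsilon> * h)" for z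
    proof -
      have za: "cmod (z - a) < d1" "cmod (z - a) < d2"
        using close[OF that] \<open>h * M < d\<close> by (auto simp: d_def)
      have "g z - D * (z - \<xi>) = (\<phi> z - \<phi> a - D * (z - a)) + of_real h * (\<psi> z - \<psi> a)"
        using D(2) by (simp add: g_def \<xi>_def field_simps)
      also have "cmod \<dots> \<le> e * cmod (z - a) + h * e'"
        using d1(2)[OF za(1)] d2(2)[OF za(2)] elim
        by (intro norm_triangle_le add_mono) (auto simp: norm_mult intro!: mult_left_mono)
      also have "\<dots> \<le> e * (h * M) + h * e'"
        using close[OF that] \<open>e > 0\<close> by (intro add_right_mono mult_left_mono) auto
      also have "\<dots> = h * (e * M + e')" by (simp add: algebra_simps)
      finally show ?thesis unfolding sum_e by (simp add: mult.commute)
    qed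
    have sub: "cball \<xi> (\<epsilon> * h) \<subseteq> S"
    proof
      fix z assume "z \<in> cball \<xi> (\<epsilon> * h)"
      then have "cmod (z - a) < d3"
        using close[of z] \<open>h * M < d\<close> by (auto simp: d_def)
      then show "z \<in> S" using d3(2) by (auto simp: dist_norm norm_minus_commute subset_iff)
    qed
    have holg: "g holomorphic_on S" unfolding g_def by (intro holomorphic_intros hol)
    have pos: "\<epsilon> * h > 0" using elim \<open>\<epsilon> > 0\<close> by simp
    \<comment> \<open>The linear part vanishes at the centre and has modulus
      \<open>cmod D * \<epsilon> * h\<close> on the circle. So \<open>g\<close> is at most one third
      of this at the centre and at least two thirds on the circle.\<close>
    have "cmod (g \<xi>) < cmod (g z)" if "cmod (\<xi> - z) = \<epsilon> * h" for z
    proof -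
      have "cmod (g \<xi>) \<le> cmod D * \<epsilon> * h / 3" using err[of \<xi>] pos by simp
      moreover have "cmod (g z - D * (z - \<xi>)) \<le> cmod D * \<epsilon> * h / 3"
        using that by (intro err) (simp add: dist_norm)
      moreover have "cmod (D * (z - \<xi>)) = cmod D * \<epsilon> * h"
        using that by (simp add: norm_mult norm_minus_commute)
      moreover have "cmod (D * (z - \<xi>)) \<le> cmod (g z) + cmod (g z - D * (z - \<xi>))"
        by (metis norm_minus_commute norm_triangle_sub)
      moreover have "cmod D * \<epsilon> * h > 0" using D(2) \<open>\<epsilon> > 0\<close> elim by simp
      ultimately show ?thesis by linarith
    qed
    moreover have "g holomorphic_on cball \<xi> (\<epsilon> * h)"
      using holg sub by (rule holomorphic_on_subset)
    ultimately obtain z where z: "z \<in> ball \<xi> (\<epsilon> * h)" "g z = 0"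
      using holomorphic_contract_to_zero[OF _ _ pos, of \<xi> g]
        holomorphic_on_imp_continuous_on holomorphic_on_subset[OF _ ball_subset_cball]
      by blast
    have "cmod (z - \<xi>) < \<epsilon> * h" using z(1) by (simp add: dist_norm norm_minus_commute)
    moreover have "\<phi> z + of_real h * \<psi> z = \<phi> a" using z(2) by (simp add: g_def)
    ultimately show ?case unfolding \<xi>_def by blast
  qed
qed

text \<open>The real part is (1 + Re k) / |1 + k|^2, and clearing denominators turns the claim into
  |k|^2 < 1.\<close>

lemma Re_inverse_gt_half:
  assumes "cmod k < 1"
  shows "Re (1 / (1 + k)) > 1 / 2"
proof -
  have "(Re k)\<^sup>2 + (Im k)\<^sup>2 < 1"
    using assms by (metis cmod_power2 norm_ge_zero power_less_one_iff zero_less_numeral abs_norm_cancel abs_square_less_1)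
  moreover have "(1 + Re k)\<^sup>2 + (Im k)\<^sup>2 > 0"
  proof -
    have "Re k > -1" using assms abs_Re_le_cmod[of k] by linarith
    then show ?thesis by (simp add: add_pos_nonneg)
  qed
  ultimately show ?thesis
    by (simp add: Re_divide field_simps power2_eq_square)
qed

text \<open>At h = 0 the left side equals \<mu> and has derivative 2 (\<eta> - Re c) \<mu> + 1,
  which the hypothesis makes negative. The term with \<eta> leaves room for the error of the Newton
  step.\<close>

lemma shrinking_modulus:
  fixes c :: complex and \<mu> :: real
  assumes "\<mu> > 0" "\<eta> < Re c - 1 / (2 * \<mu>)"
  shows "\<forall>\<^sub>F h in at_right 0. (cmod (1 - of_real h * c) + \<eta> * h)\<^sup>2 * (\<mu> + h) < \<mu>"
proof -
  \<comment> \<open>The modulus is expanded into a square root, so that the rules for real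
    derivatives apply at 0.\<close>
  define m where "m = (\<lambda>h. (sqrt ((1 - h * Re c)\<^sup>2 + (h * Im c)\<^sup>2) + \<eta> * h)\<^sup>2 * (\<mu> + h))"
  have "(m has_real_derivative 2 * (\<eta> - Re c) * \<mu> + 1) (at 0)"
    unfolding m_def by (auto intro!: derivative_eq_intros simp: field_simps)
  moreover have "2 * (\<eta> - Re c) * \<mu> + 1 < 0"
    using assms by (simp add: field_simps)
  ultimately obtain d where "d > 0" "\<And>h. 0 < h \<Longrightarrow> h < d \<Longrightarrow> m (0 + h) < m 0"
    using DERIV_neg_dec_right by blast
  then have "\<forall>\<^sub>F h in at_right 0. m h < m 0"
    by (intro eventually_at_rightI[of 0 d]) auto
  then show ?thesis
    by (simp add: m_def cmod_def)
qed

section \<open>Becker's univalence criterion\<close>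

locale becker_condition =
  fixes f :: "complex \<Rightarrow> complex"
  assumes holf: "f holomorphic_on unit_disc"
    and deriv_nz: "z \<in> unit_disc \<Longrightarrow> deriv f z \<noteq> 0"
    and becker: "z \<in> unit_disc \<Longrightarrow> (1 - (cmod z)\<^sup>2) * cmod (z * deriv (deriv f) z / deriv f z) \<le> 1"
begin

text \<open>Put u = e^(-s) z and l = e^(2s) - 1: this becomes the classical chain f(e^(-s) z) + (e^s
  - e^(-s)) z f'(e^(-s) z), and |u|^2 (1 + l) becomes |z|^2.\<close>

definition G :: "real \<Rightarrow> complex \<Rightarrow> complex" where
  "G l z = f z + of_real l * (z * deriv f z)"

definition G' :: "real \<Rightarrow> complex \<Rightarrow> complex" where
  "G' l z = of_real (1 + l) * deriv f z + of_real l * (z * deriv (deriv f) z)"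

lemma hol_deriv: "deriv f holomorphic_on unit_disc" "deriv (deriv f) holomorphic_on unit_disc"
  by (rule holomorphic_deriv[OF holf open_ball])
     (rule holomorphic_deriv[OF holomorphic_deriv[OF holf open_ball] open_ball])

lemma has_field_derivative_G:
  assumes "z \<in> unit_disc"
  shows "(G l has_field_derivative G' l z) (at z)"
proof -
  have "(f has_field_derivative deriv f z) (at z)" "(deriv f has_field_derivative deriv (deriv f) z) (at z)"
    using assms holf hol_deriv(1) by (auto intro: holomorphic_derivI)
  then show ?thesis
    unfolding G_def[abs_def] G'_def by (auto intro!: derivative_eq_intros simp: algebra_simps)
qed

lemma holomorphic_G: "G l holomorphic_on unit_disc"
  unfolding holomorphic_on_open[OF open_ball] using has_field_derivative_G by blast

lemma in_unit_disc:
  assumes "r < 1" "l \<ge> 0" "(cmod u)\<^sup>2 * (1 + l) \<le> r\<^sup>2" "r > 0"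
  shows "u \<in> unit_disc"
proof -
  have "(cmod u)\<^sup>2 * 1 \<le> (cmod u)\<^sup>2 * (1 + l)"
    using assms by (intro mult_left_mono) auto
  also have "\<dots> < 1" using assms by (smt (verit) power_less_one_iff zero_less_numeral)
  finally show ?thesis by (simp add: abs_square_less_1)
qed

text \<open>Here k = l / (1 + l) times u f''(u) / f'(u). The region gives l / (1 + l) < 1 - |u|^2,
  so Becker's inequality yields |k| < 1; this is the one place where that inequality enters.\<close>

lemma G'_factor:
  assumes "0 < r" "r < 1" "l \<ge> 0" "(cmod u)\<^sup>2 * (1 + l) \<le> r\<^sup>2"
  obtains k where "cmod k < 1" "G' l u = of_real (1 + l) * deriv f u * (1 + k)"
proof
  define q where "q = u * deriv (deriv f) u / deriv f u"
  define k where "k = of_real (l / (1 + l)) * q"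
  have u: "u \<in> unit_disc" using in_unit_disc assms by blast
  have "of_real (1 + l) \<noteq> (0::complex)" using \<open>l \<ge> 0\<close> by (simp only: of_real_eq_0_iff)
  then have k_eq: "of_real (1 + l) * k = of_real l * q" by (simp add: k_def del: of_real_add)
  have "of_real (1 + l) * deriv f u * (1 + k) = of_real (1 + l) * deriv f u + (of_real (1 + l) * k) * deriv f u"
    by (simp only: algebra_simps mult_1_left)
  also have "(of_real (1 + l) * k) * deriv f u = of_real l * (q * deriv f u)"
    unfolding k_eq by simp
  also have "q * deriv f u = u * deriv (deriv f) u"
    using deriv_nz[OF u] by (simp add: q_def)
  finally show "G' l u = of_real (1 + l) * deriv f u * (1 + k)" by (simp add: G'_def)
  have "(cmod u)\<^sup>2 * (1 + l) < 1" using assms by (smt (verit) power_less_one_iff zero_less_numeral)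
  then have "l / (1 + l) < 1 - (cmod u)\<^sup>2" using \<open>l \<ge> 0\<close> by (simp add: field_simps)
  moreover have "(1 - (cmod u)\<^sup>2) * cmod q \<le> 1" using becker[OF u] by (simp add: q_def)
  moreover have "cmod k = l / (1 + l) * cmod q"
    unfolding k_def norm_mult norm_of_real using \<open>l \<ge> 0\<close> by simp
  \<comment> \<open>Strict monotonicity of multiplication requires a positive factor, hence the
    separate case \<open>q = 0\<close>.\<close>
  ultimately show "cmod k < 1"
    using mult_strict_right_mono[of "l / (1 + l)" "1 - (cmod u)\<^sup>2" "cmod q"]
    by (cases "q = 0") auto
qed

lemma G'_nz:
  assumes "0 < r" "r < 1" "l \<ge> 0" "(cmod u)\<^sup>2 * (1 + l) \<le> r\<^sup>2"
  shows "G' l u \<noteq> 0"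
proof -
  obtain k where k: "cmod k < 1" "G' l u = of_real (1 + l) * deriv f u * (1 + k)"
    using G'_factor assms by blast
  have "1 + k \<noteq> 0" using k(1) by (metis add_eq_0_iff norm_minus_cancel norm_one less_irrefl)
  moreover have "of_real (1 + l) \<noteq> (0::complex)" using \<open>l \<ge> 0\<close> by (simp only: of_real_eq_0_iff)
  ultimately show ?thesis using k(2) deriv_nz in_unit_disc assms by auto
qed

text \<open>
  Implicitly differentiating \<open>G l u = const\<close> gives \<open>du/dl = - u / ((1 + l) (1 + k))\<close>, along which
  \<open>\<bar>u\<bar>\<^sup>2 (1 + l)\<close> decreases because \<open>Re (1 / (1 + k)) > 1 / 2\<close>. Hence a level point can be followed
  towards larger \<open>l\<close> without leaving the region.
\<close>
lemma follow_level_point: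
  assumes r: "0 < r" "r < 1" "l \<ge> 0" "(cmod u)\<^sup>2 * (1 + l) \<le> r\<^sup>2" and "e > 0"
  shows "\<forall>\<^sub>F h in at_right 0. \<exists>z. G (l + h) z = G l u \<and> cmod (z - u) < e \<and>
           (cmod z)\<^sup>2 * (1 + (l + h)) \<le> r\<^sup>2"
proof (cases "u = 0")
  case True
  \<comment> \<open>The origin is a level point for every parameter:
    \<open>G l 0 = f 0\<close>.\<close>
  then show ?thesis using \<open>e > 0\<close> by (intro always_eventually allI exI[of _ 0]) (auto simp: G_def)
next
  case False
  obtain k where k: "cmod k < 1" "G' l u = of_real (1 + l) * deriv f u * (1 + k)"
    using G'_factor r by blast
  \<comment> \<open>The logarithmic velocity (du/dl) / u equals \<open>- c\<close>.\<close>
  define c where "c = 1 / (of_real (1 + l) * (1 + k))"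
  have u: "u \<in> unit_disc" using in_unit_disc r by blast
  have c_eq: "u * deriv f u / G' l u = u * c"
    using deriv_nz[OF u] by (simp add: k(2) c_def)
  have "Re c = Re (1 / (1 + k)) / (1 + l)"
    by (metis Re_divide_of_real c_def divide_divide_eq_left mult.commute)
  then have Re_c: "Re c > 1 / (2 * (1 + l))"
    using Re_inverse_gt_half[OF k(1)] \<open>l \<ge> 0\<close> by (simp add: field_simps)
  \<comment> \<open>Half of the available slack. The error radius is taken as
    \<open>\<eta> * cmod u * h\<close>, proportional to \<open>cmod u\<close>, so that
    \<open>cmod u\<close> factors out and \<open>shrinking_modulus\<close> applies with \<mu> = 1 +
    l. The perturbation is z f'(z), since it is the coefficient of l in \<open>G\<close>.\<close>
  define \<eta> where "\<eta> = (Re c - 1 / (2 * (1 + l))) / 2"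
  have \<eta>: "\<eta> > 0" "\<eta> < Re c - 1 / (2 * (1 + l))" using Re_c by (auto simp: \<eta>_def)
  have "\<forall>\<^sub>F h in at_right 0. \<exists>z. G l z + of_real h * (z * deriv f z) = G l u \<and>
      cmod (z - (u - of_real h * (u * deriv f u) / G' l u)) < (\<eta> * cmod u) * h"
    using u \<eta> False
    by (intro perturbed_root[of unit_disc] has_field_derivative_G holomorphic_G G'_nz[OF r]
        holomorphic_intros hol_deriv) auto
  moreover have "\<forall>\<^sub>F h in at_right 0. (cmod (1 - of_real h * c) + \<eta> * h)\<^sup>2 * ((1 + l) + h) < 1 + l"
    using \<eta> \<open>l \<ge> 0\<close> by (intro shrinking_modulus) auto
  moreover have "\<forall>\<^sub>F h in at_right 0. h * (cmod (u * c) + \<eta> * cmod u) < e"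
  proof -
    have "((\<lambda>h. h * (cmod (u * c) + \<eta> * cmod u)) \<longlongrightarrow> 0 * (cmod (u * c) + \<eta> * cmod u)) (at_right 0)"
      by (intro tendsto_intros)
    then show ?thesis using \<open>e > 0\<close> by (intro order_tendstoD(2)) auto
  qed
  moreover have "\<forall>\<^sub>F h in at_right (0::real). h > 0" by (rule eventually_at_right_less)
  ultimately show ?thesis
  proof eventually_elim
    case (elim h)
    then obtain z where z: "G l z + of_real h * (z * deriv f z) = G l u"
        "cmod (z - (u - of_real h * (u * c))) < (\<eta> * cmod u) * h"
      using c_eq by (metis times_divide_eq_right)
    have "cmod (z - u) \<le> cmod (z - (u - of_real h * (u * c))) + cmod (of_real h * (u * c))"
      by (rule order_trans[OF _ norm_triangle_ineq4]) (simp add: algebra_simps)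
    then have "cmod (z - u) < e"
      using z(2) elim by (simp add: norm_mult algebra_simps)
    moreover have "(cmod z)\<^sup>2 * (1 + (l + h)) \<le> r\<^sup>2"
    proof -
      have "cmod z \<le> cmod (u - of_real h * (u * c)) + cmod (z - (u - of_real h * (u * c)))"
        by (rule norm_triangle_sub)
      also have "\<dots> \<le> cmod (u - of_real h * (u * c)) + \<eta> * cmod u * h"
        using z(2) by simp
      also have "u - of_real h * (u * c) = u * (1 - of_real h * c)" by (simp add: algebra_simps)
      also have "cmod \<dots> + \<eta> * cmod u * h = cmod u * (cmod (1 - of_real h * c) + \<eta> * h)"
        by (simp add: norm_mult distrib_left)
      finally have "cmod z \<le> cmod u * (cmod (1 - of_real h * c) + \<eta> * h)" .
      then have "(cmod z)\<^sup>2 \<le> (cmod u * (cmod (1 - of_real h * c) + \<eta> * h))\<^sup>2"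
        by (intro power_mono) auto
      then have "(cmod z)\<^sup>2 * (1 + (l + h))
          \<le> (cmod u * (cmod (1 - of_real h * c) + \<eta> * h))\<^sup>2 * (1 + (l + h))"
        using \<open>l \<ge> 0\<close> elim by (intro mult_right_mono) auto
      also have "\<dots> = (cmod u)\<^sup>2 * ((cmod (1 - of_real h * c) + \<eta> * h)\<^sup>2 * ((1 + l) + h))"
        by (simp only: power_mult_distrib mult.assoc add.assoc)
      also have "\<dots> \<le> (cmod u)\<^sup>2 * (1 + l)"
        using elim by (intro mult_left_mono) auto
      finally show ?thesis using r by linarith
    qed
    moreover have "G (l + h) z = G l u"
      using z(1) by (simp add: G_def algebra_simps)
    ultimately show ?case by blast
  qed
qed

text \<open>\<open>G'\<close> is jointly continuous in parameter and point, so one radius serves all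
  nearby parameters. This uniformity keeps colliding pairs from merging in a limit.\<close>

lemma locally_inj_G:
  assumes "0 < r" "r < 1" "l \<ge> 0" "(cmod u)\<^sup>2 * (1 + l) \<le> r\<^sup>2"
  obtains e where "e > 0" "\<And>l'. \<bar>l' - l\<bar> < e \<Longrightarrow> inj_on (G l') (ball u e)"
proof -
  define c where "c = G' l u"
  have c: "c \<noteq> 0" using G'_nz assms by (simp add: c_def)
  have u: "u \<in> unit_disc" using in_unit_disc assms by blast
  have "isCont (deriv f) u" "isCont (deriv (deriv f)) u"
    using u hol_deriv continuous_on_eq_continuous_at holomorphic_on_imp_continuous_on open_ball by blast+
  then have lim: "(deriv f \<longlongrightarrow> deriv f u) (nhds u)" "(deriv (deriv f) \<longlongrightarrow> deriv (deriv f) u) (nhds u)"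
    by (auto simp: continuous_within tendsto_nhds_iff)
  have "((\<lambda>p. G' (fst p) (snd p)) \<longlongrightarrow> c) (nhds l \<times>\<^sub>F nhds u)"
    unfolding G'_def c_def
    by (intro tendsto_intros filterlim_compose[OF lim(1)] filterlim_compose[OF lim(2)]
        filterlim_fst filterlim_snd)
  then have "\<forall>\<^sub>F p in nhds l \<times>\<^sub>F nhds u. dist (G' (fst p) (snd p)) c < cmod c / 2"
    using c by (intro tendstoD) auto
  then obtain P Q where PQ: "eventually P (nhds l)" "eventually Q (nhds u)"
    "\<And>x y. P x \<Longrightarrow> Q y \<Longrightarrow> dist (G' x y) c < cmod c / 2"
    unfolding eventually_prod_filter by auto
  obtain e1 where e1: "e1 > 0" "\<And>x. dist x l < e1 \<Longrightarrow> P x"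
    using PQ(1) eventually_nhds_metric by blast
  obtain e2 where e2: "e2 > 0" "\<And>x. dist x u < e2 \<Longrightarrow> Q x"
    using PQ(2) eventually_nhds_metric by blast
  obtain e3 where e3: "e3 > 0" "ball u e3 \<subseteq> unit_disc"
    using u open_ball openE by blast
  show ?thesis
  proof
    show "Min {e1, e2, e3} > 0" using e1 e2 e3 by simp
    fix l' assume l': "\<bar>l' - l\<bar> < Min {e1, e2, e3}"
    show "inj_on (G l') (ball u (Min {e1, e2, e3}))"
    proof (rule inj_on_if_deriv_near_const[OF convex_ball _ _ c])
      fix z assume z: "z \<in> ball u (Min {e1, e2, e3})"
      then have "z \<in> unit_disc" using e3 by auto
      then show "(G l' has_field_derivative G' l' z) (at z)" by (rule has_field_derivative_G)
      have "P l'" using e1 l' by (auto simp: dist_real_def)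
      moreover have "Q z" using e2 z by (auto simp: dist_commute)
      ultimately show "cmod (G' l' z - c) \<le> cmod c / 2"
        using PQ(3)[of l' z] by (simp add: dist_norm)
    qed
  qed
qed

text \<open>Near 0 the derivative \<open>G' L z\<close> is close to (1 + L) f'(0), with relative
  error independent of L. So the disc of injectivity is fixed first, and L is then taken large
  enough to shrink the region into it.\<close>

lemma inj_G_large:
  obtains L where "L \<ge> 0" "inj_on (G L) {z. (cmod z)\<^sup>2 * (1 + L) \<le> 1}"
proof -
  define c where "c = deriv f 0"
  have c: "c \<noteq> 0" using deriv_nz by (simp add: c_def)
  have "isCont (deriv f) 0" "isCont (deriv (deriv f)) 0"
    using hol_deriv continuous_on_eq_continuous_at holomorphic_on_imp_continuous_on open_ball
    by (metis centre_in_ball zero_less_one)+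
  then have "isCont (deriv f) 0" "isCont (\<lambda>z. z * deriv (deriv f) z) 0"
    by (auto intro!: continuous_intros)
  then have lim: "(deriv f \<longlongrightarrow> c) (nhds 0)" "((\<lambda>z. z * deriv (deriv f) z) \<longlongrightarrow> 0) (nhds 0)"
    by (auto simp: continuous_within tendsto_nhds_iff c_def)
  have "\<forall>\<^sub>F z in nhds 0. dist (deriv f z) c < cmod c / 4 \<and> dist (z * deriv (deriv f) z) 0 < cmod c / 4"
    using c lim by (intro eventually_conj tendstoD) auto
  then obtain e where e: "e > 0" "\<And>z. cmod z < e \<Longrightarrow> cmod (deriv f z - c) < cmod c / 4"
      "\<And>z. cmod z < e \<Longrightarrow> cmod (z * deriv (deriv f) z) < cmod c / 4"
    unfolding eventually_nhds_metric dist_norm by auto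
  define d where "d = min e 1"
  have d: "0 < d" "d \<le> e" "d \<le> 1" using e by (auto simp: d_def)
  \<comment> \<open>With this choice the region satisfies |z|^2 \<le> d^2 / (1 + d^2) < d^2.\<close>
  define L where "L = 1 / d\<^sup>2"
  have "L > 0" using d by (simp add: L_def)
  have "inj_on (G L) (ball 0 d)"
  proof (rule inj_on_if_deriv_near_const[OF convex_ball])
    show "of_real (1 + L) * c \<noteq> 0" using c \<open>L > 0\<close> by (simp only: mult_eq_0_iff of_real_eq_0_iff) simp
    fix z :: complex assume z: "z \<in> ball 0 d"
    then show "(G L has_field_derivative G' L z) (at z)" using d by (intro has_field_derivative_G) auto
    have ze: "cmod z < e" using z d by simp
    have "G' L z - of_real (1 + L) * c = of_real (1 + L) * (deriv f z - c) + of_real L * (z * deriv (deriv f) z)"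
      by (simp add: G'_def algebra_simps)
    also have "cmod \<dots> \<le> (1 + L) * (cmod c / 4) + (1 + L) * (cmod c / 4)"
    proof (intro norm_triangle_le add_mono)
      show "cmod (of_real (1 + L) * (deriv f z - c)) \<le> (1 + L) * (cmod c / 4)"
        unfolding norm_mult norm_of_real using e(2)[OF ze] \<open>L > 0\<close> by (intro mult_mono) auto
      show "cmod (of_real L * (z * deriv (deriv f) z)) \<le> (1 + L) * (cmod c / 4)"
        unfolding norm_mult[of "of_real L"] norm_of_real using e(3)[OF ze] \<open>L > 0\<close> by (intro mult_mono) auto
    qed
    also have "\<dots> = cmod (of_real (1 + L) * c) / 2"
      unfolding norm_mult norm_of_real using \<open>L > 0\<close> by simp
    finally show "cmod (G' L z - of_real (1 + L) * c) \<le> cmod (of_real (1 + L) * c) / 2" .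
  qed
  moreover have "{z. (cmod z)\<^sup>2 * (1 + L) \<le> 1} \<subseteq> ball 0 d"
  proof
    fix z assume "z \<in> {z. (cmod z)\<^sup>2 * (1 + L) \<le> 1}"
    then have "(cmod z)\<^sup>2 * (1 + 1 / d\<^sup>2) \<le> 1" by (simp add: L_def)
    then have "(cmod z)\<^sup>2 * (d\<^sup>2 + 1) \<le> d\<^sup>2" using d by (simp add: field_simps)
    moreover have "(cmod z)\<^sup>2 * d\<^sup>2 > 0 \<or> z = 0" using d by auto
    ultimately have "(cmod z)\<^sup>2 < d\<^sup>2" using d by (auto simp: algebra_simps)
    then show "z \<in> ball 0 d" using d power2_less_imp_less[of "cmod z" d] by simp
  qed
  ultimately show ?thesis
    using that[of L] \<open>L > 0\<close> inj_on_subset by (metis less_imp_le)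
qed

theorem inj_on_unit_disc: "inj_on f unit_disc"
proof (rule inj_onI, rule ccontr)
  fix a b assume ab: "a \<in> unit_disc" "b \<in> unit_disc" "f a = f b" "a \<noteq> b"
  define r where "r = max (cmod a) (cmod b)"
  have r: "0 < r" "r < 1" using ab by (auto simp: r_def max_def)
  obtain L where L: "L \<ge> 0" "inj_on (G L) {z. (cmod z)\<^sup>2 * (1 + L) \<le> 1}"
    by (rule inj_G_large)
  \<comment> \<open>\<open>A\<close> is a compact box, and \<open>H\<close> collects the defining
    conditions so that \<open>K0\<close> is the preimage of a closed set under a continuous map.
    \<open>K\<close> removes the diagonal, so its closedness needs its own argument.\<close>
  define A where "A = cball (0::complex) r \<times> cball (0::complex) r \<times> {0..L}"
  define H where "H = (\<lambda>(u, v, l). ((cmod u)\<^sup>2 * (1 + l), (cmod v)\<^sup>2 * (1 + l), G l u - G l v))"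
  define K0 where "K0 = A \<inter> H -` ({..r\<^sup>2} \<times> {..r\<^sup>2} \<times> {0})"
  define K where "K = {p \<in> K0. fst p \<noteq> fst (snd p)}"
  have K0_iff: "(u, v, l) \<in> K0 \<longleftrightarrow> 0 \<le> l \<and> l \<le> L \<and> (cmod u)\<^sup>2 * (1 + l) \<le> r\<^sup>2 \<and>
      (cmod v)\<^sup>2 * (1 + l) \<le> r\<^sup>2 \<and> G l u = G l v" for u v l
  proof -
    have "cmod w \<le> r" if "0 \<le> l" "(cmod w)\<^sup>2 * (1 + l) \<le> r\<^sup>2" for w
    proof -
      have "(cmod w)\<^sup>2 * 1 \<le> (cmod w)\<^sup>2 * (1 + l)" using that by (intro mult_left_mono) auto
      then have "(cmod w)\<^sup>2 \<le> r\<^sup>2" using that by linarith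
      then show ?thesis using r power2_le_imp_le by (metis less_imp_le)
    qed
    then show ?thesis by (auto simp: K0_def A_def H_def)
  qed
  have "compact A" unfolding A_def by (intro compact_Times) auto
  have "continuous_on A H"
  proof -
    have cont: "continuous_on unit_disc f" "continuous_on unit_disc (deriv f)"
      using holf hol_deriv by (auto intro: holomorphic_on_imp_continuous_on)
    have sub: "fst ` A \<subseteq> unit_disc" "(\<lambda>p. fst (snd p)) ` A \<subseteq> unit_disc"
      using r by (auto simp: A_def)
    show ?thesis
      unfolding H_def G_def case_prod_unfold
      by (intro continuous_intros continuous_on_compose2[OF cont(1)] continuous_on_compose2[OF cont(2)] sub)
  qed
  then have "closed K0"
    unfolding K0_def using \<open>compact A\<close>
    by (intro continuous_closed_preimage closed_Times) (auto intro: compact_imp_closed)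
  have "closed K"
    unfolding closed_sequential_limits
  proof (intro allI impI)
    fix x p assume "(\<forall>n. x n \<in> K) \<and> x \<longlonglongrightarrow> p"
    then have xK: "\<And>n. x n \<in> K" and lim: "x \<longlonglongrightarrow> p" by auto
    obtain u v l where p: "p = (u, v, l)" by (cases p)
    have pK0: "p \<in> K0"
      using \<open>closed K0\<close> xK lim unfolding closed_sequential_limits K_def by blast
    show "p \<in> K"
    proof (rule ccontr)
      assume "p \<notin> K"
      then have [simp]: "v = u" using pK0 by (simp add: K_def p)
      \<comment> \<open>If a limit of collisions lay on the diagonal, distinct points arbitrarily
        close to \<open>u\<close> would have equal images under \<open>G l'\<close> with
        \<open>l'\<close> near \<open>l\<close>, against local injectivity.\<close>
      obtain e where e: "e > 0" "\<And>l'. \<bar>l' - l\<bar> < e \<Longrightarrow> inj_on (G l') (ball u e)"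
        using locally_inj_G[OF r, of l u] pK0 by (auto simp: p K0_iff)
      have "\<forall>\<^sub>F n in sequentially. dist (x n) p < e" using lim e(1) by (rule tendstoD)
      then obtain n where n: "dist (x n) p < e" by (auto simp: eventually_sequentially)
      obtain u' v' l' where xn: "x n = (u', v', l')" by (cases "x n")
      have "dist u' u < e" "dist v' u < e" "dist l' l < e"
        using n dist_fst_le[of "x n" p] dist_snd_le[of "x n" p]
          dist_fst_le[of "snd (x n)" "snd p"] dist_snd_le[of "snd (x n)" "snd p"]
        by (auto simp: xn p)
      moreover have "G l' u' = G l' v'" "u' \<noteq> v'"
        using xK[of n] by (auto simp: K_def xn K0_iff)
      ultimately show False
        using e(2)[of l'] by (auto simp: dist_real_def dist_commute inj_on_def)
    qed
  qed
  have "compact K"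
  proof -
    have "K = A \<inter> K" by (auto simp: K_def K0_def)
    then show ?thesis using compact_Int_closed[OF \<open>compact A\<close> \<open>closed K\<close>] by simp
  qed
  moreover have "(cmod a)\<^sup>2 \<le> r\<^sup>2" "(cmod b)\<^sup>2 \<le> r\<^sup>2"
    by (intro power_mono; simp add: r_def)+
  then have "(a, b, 0) \<in> K"
    using ab L(1) by (simp add: K_def K0_iff G_def)
  moreover have "continuous_on K (\<lambda>p. snd (snd p))" by (intro continuous_intros)
  ultimately obtain p where p: "p \<in> K" "\<And>q. q \<in> K \<Longrightarrow> snd (snd q) \<le> snd (snd p)"
    using continuous_attains_sup[of K "\<lambda>p. snd (snd p)"] by blast
  obtain u v l where puv: "p = (u, v, l)" by (cases p)
  have uv: "u \<noteq> v" "0 \<le> l" "l \<le> L" "(cmod u)\<^sup>2 * (1 + l) \<le> r\<^sup>2" "(cmod v)\<^sup>2 * (1 + l) \<le> r\<^sup>2"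
      "G l u = G l v"
    using p(1) by (auto simp: K_def K0_iff puv)
  have "r\<^sup>2 \<le> 1" using r by (simp add: power_le_one)
  \<comment> \<open>As r \<le> 1, both points lie in the region on which \<open>G L\<close> is
    injective.\<close>
  then have "l \<noteq> L" using uv L(2) by (auto simp: inj_on_def)
  then have "l < L" using uv by simp
  \<comment> \<open>Points moved by less than half the distance between \<open>u\<close> and
    \<open>v\<close> stay distinct.\<close>
  define e where "e = cmod (u - v) / 2"
  have "e > 0" using uv by (simp add: e_def)
  have "\<forall>\<^sub>F h in at_right 0. h < L - l"
    using \<open>l < L\<close> by (intro eventually_at_rightI[of 0 "L - l"]) auto
  then have "\<forall>\<^sub>F h in at_right 0. \<exists>z w. h > 0 \<and> (z, w, l + h) \<in> K"
    using follow_level_point[OF r uv(2,4) \<open>e > 0\<close>] follow_level_point[OF r uv(2,5) \<open>e > 0\<close>]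
      eventually_at_right_less[of 0]
  proof eventually_elim
    case (elim h)
    then obtain z w where z: "G (l + h) z = G l u" "cmod (z - u) < e" "(cmod z)\<^sup>2 * (1 + (l + h)) \<le> r\<^sup>2"
      and w: "G (l + h) w = G l v" "cmod (w - v) < e" "(cmod w)\<^sup>2 * (1 + (l + h)) \<le> r\<^sup>2"
      by blast
    have "z \<noteq> w"
    proof
      assume "z = w"
      have "cmod (u - v) \<le> cmod (z - u) + cmod (z - v)"
        by (metis dist_norm dist_triangle2 norm_minus_commute)
      then show False using z(2) w(2) \<open>z = w\<close> by (simp add: e_def)
    qed
    moreover have "0 < h" "h < L - l" using elim by auto
    ultimately have "(z, w, l + h) \<in> K" using z w uv by (simp add: K_def K0_iff)
    then show ?case using \<open>0 < h\<close> by blast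
  qed
  then obtain h z w where "h > 0" "(z, w, l + h) \<in> K"
    using eventually_happens'[OF trivial_limit_at_right_real] by blast
  then show False using p(2)[of "(z, w, l + h)"] by (simp add: puv)
qed

end

section \<open>From the half-plane condition to Becker's inequality\<close>

text \<open>The points 0 and t are mirror images in the line Re w = t / 2, so w / (w - t) maps the
  half-plane Re w < t / 2 into the unit disc and fixes 0. The Schwarz lemma gives |p| \<le> |z| |p -
  t| for the rotated function \<open>p\<close>, and the triangle inequality does the rest.\<close>

lemma pre_schwarzian_bound:
  fixes q :: "complex \<Rightarrow> complex"
  assumes hol: "q holomorphic_on unit_disc" and "q 0 = 0" and "t > 0"
    and Re: "\<And>z. z \<in> unit_disc \<Longrightarrow> Re (exp (\<i> * of_real \<theta>) * q z) < t / 2"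
    and z: "z \<in> unit_disc"
  shows "(1 - cmod z) * cmod (q z) \<le> t * cmod z"
proof -
  define p where "p = (\<lambda>z. exp (\<i> * of_real \<theta>) * q z)"
  define \<omega> where "\<omega> = (\<lambda>z. p z / (p z - of_real t))"
  have nz: "p z - of_real t \<noteq> 0" if "z \<in> unit_disc" for z
  proof -
    have "Re (p z - of_real t) < 0" using Re[OF that] \<open>t > 0\<close> by (simp add: p_def)
    then show ?thesis by auto
  qed
  have "cmod (\<omega> z) \<le> cmod z"
  proof (rule Schwarz_Lemma(1))
    show "\<omega> holomorphic_on unit_disc"
      unfolding \<omega>_def p_def using nz by (intro holomorphic_intros hol) (auto simp: p_def)
    show "\<omega> 0 = 0" using \<open>q 0 = 0\<close> by (simp add: \<omega>_def p_def)
    show "cmod z < 1" using z by simp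
    fix z :: complex assume "cmod z < 1"
    then have z: "z \<in> unit_disc" by simp
    have "(cmod (p z))\<^sup>2 < (cmod (p z - of_real t))\<^sup>2"
    proof -
      have "t * Re (p z) < t * (t / 2)"
        using Re[OF z] \<open>t > 0\<close> unfolding p_def by (intro mult_strict_left_mono)
      then show ?thesis unfolding cmod_power2 by (simp add: power2_eq_square algebra_simps)
    qed
    then have "cmod (p z) < cmod (p z - of_real t)" using power2_less_imp_less by fastforce
    then show "cmod (\<omega> z) < 1" using nz[OF z] by (simp add: \<omega>_def norm_divide)
  qed
  then have "cmod (p z) \<le> cmod z * cmod (p z - of_real t)"
    using nz[OF z] by (simp add: \<omega>_def norm_divide divide_le_eq)
  also have "\<dots> \<le> cmod z * (cmod (p z) + t)"
    using \<open>t > 0\<close> norm_triangle_ineq4[of "p z" "of_real t"] by (intro mult_left_mono) auto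
  finally have "(1 - cmod z) * cmod (p z) \<le> t * cmod z" by (simp add: algebra_simps)
  then show ?thesis by (simp add: p_def norm_mult)
qed

lemma delta_less_1_imp:
  assumes "\<gamma> > 0" "cos \<theta> > 0" "delta \<gamma> \<theta> < 1"
  shows "\<gamma> * cos \<theta> < 1 / 2"
proof -
  have "2 \<le> sqrt (4 + (\<gamma>\<^sup>2 + 4 * \<gamma>) * (cos \<theta>)\<^sup>2)"
    using assms by (intro real_le_rsqrt) simp
  then have "\<gamma> * cos \<theta> * 2 \<le> delta \<gamma> \<theta>"
    unfolding delta_def using assms by (intro mult_left_mono) auto
  then show ?thesis using assms by simp
qed

theorem mainTheorem6:
  fixes \<theta> \<gamma> :: real
  assumes "\<bar>\<theta>\<bar> < pi / 2" and "\<gamma> > 0"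
    and "delta \<gamma> \<theta> \<in> {0..<1}"
  shows "\<forall>f \<in> class_C \<theta> \<gamma>. inj_on f unit_disc"
proof
  fix f assume f: "f \<in> class_C \<theta> \<gamma>"
  define t where "t = \<gamma> * cos \<theta>"
  have cos: "cos \<theta> > 0" using assms(1) by (intro cos_gt_zero_pi) auto
  have t: "t > 0" "t < 1 / 2" using assms cos delta_less_1_imp by (auto simp: t_def)
  have hol: "f holomorphic_on unit_disc" and nz: "\<And>z. z \<in> unit_disc \<Longrightarrow> deriv f z \<noteq> 0"
    using f by (auto simp: class_C_def class_A_def)
  define q where "q = (\<lambda>z. z * deriv (deriv f) z / deriv f z)"
  have holq: "q holomorphic_on unit_disc"
    unfolding q_def using nz by (intro holomorphic_intros holomorphic_deriv hol) auto
  have Re: "Re (exp (\<i> * of_real \<theta>) * q z) < t / 2" if "z \<in> unit_disc" for z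
  proof -
    have "Re (exp (\<i> * of_real \<theta>) * (1 + q z)) < (1 + \<gamma> / 2) * cos \<theta>"
      using f that by (auto simp: class_C_def q_def)
    moreover have "Re (exp (\<i> * of_real \<theta>)) = cos \<theta>" by (simp add: Re_exp)
    \<comment> \<open>The summand 1 contributes cos \<theta> on the left, which cancels and leaves
      \<gamma> cos \<theta> / 2 on the right.\<close>
    ultimately show ?thesis unfolding distrib_left by (simp add: t_def algebra_simps)
  qed
  interpret becker_condition f
  proof
    show "f holomorphic_on unit_disc" by (rule hol)
    fix z :: complex assume z: "z \<in> unit_disc"
    then show "deriv f z \<noteq> 0" by (rule nz)
    have "(1 - cmod z) * cmod (q z) \<le> t * cmod z"
      using pre_schwarzian_bound[OF holq _ t(1) Re z] by (simp add: q_def)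
    \<comment> \<open>The factor 1 + |z| completes 1 - |z| to 1 - |z|^2. It is below 2 on the disc,
      which is why t < 1/2 is the bound extracted from \<open>delta\<close>.\<close>
    then have "(1 + cmod z) * ((1 - cmod z) * cmod (q z)) \<le> (1 + cmod z) * (t * cmod z)"
      by (intro mult_left_mono) auto
    also have "\<dots> \<le> 2 * (1 / 2 * 1)" using t z by (intro mult_mono) auto
    finally show "(1 - (cmod z)\<^sup>2) * cmod (z * deriv (deriv f) z / deriv f z) \<le> 1"
      by (simp add: q_def power2_eq_square algebra_simps)
  qed
  show "inj_on f unit_disc" by (rule inj_on_unit_disc)
qed

end
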